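(* Let $n\ge 1$ and let $\mathcal{E}_n$ be the Fomin–Kirillov quadratic algebra. For $p\in\{1,\ldots,n\}$ define the $K$-theoretic Dunkl element \[\kappa_p:=1-(1+[p-1,p])(1+[p-2,p])\cdots(1+[1p])(1+[np])(1+[n-1,p])\cdots(1+[p+1,p])\in\mathcal{E}_n.\] Then $\kappa_p\kappa_q=\kappa_q\kappa_p$ in $\mathcal{E}_n$ for all $p,q\in\{1,\ldots,n\}$.
   Context: The quadratic algebra $\mathcal{E}_n$ is the associative algebra (over $\mathbb{Z}$, with unit $1$) with generators $[ij]$ for $1\le i\ne j\le n$, subject to the relations: (i) $[ij]+[ji]=0$; (ii) $[ij]^2=0$; (iii) $[ij][jk]+[jk][ki]+[ki][ij]=0$; (iv) $[ij][kl]=[kl][ij]$, for all pairwise distinct $i,j,k,l$. In the definition of $\kappa_p$ the product runs over all $i\neq p$, in the order $i=p-1,p-2,\ldots,1,n,n-1,\ldots,p+1$. *)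

theory Defs
  imports "HOL-Library.Poly_Mapping" "HOL-Algebra.QuotRing"
begin

text \<open>
  The free monoid on a set of letters, written additively: with this class instance the
  convolution product on finitely supported maps from words to integers is the
  (noncommutative) product of the free associative ring.
\<close>

datatype 'a fword = FWord (letters: "'a list")

instantiation fword :: (type) monoid_add
begin

definition zero_fword :: "'a fword" where
  "0 = FWord []"

definition plus_fword :: "'a fword \<Rightarrow> 'a fword \<Rightarrow> 'a fword" where
  "u + v = FWord (letters u @ letters v)"

instance
  by standard (simp_all add: zero_fword_def plus_fword_def)

end

definition free_ring :: "'a set \<Rightarrow> ('a fword \<Rightarrow>\<^sub>0 int) ring" where
  "free_ring X =
    \<lparr>carrier = {f. \<forall>w \<in> Poly_Mapping.keys f. set (letters w) \<subseteq> X},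
     mult = (*), one = 1, zero = 0, add = (+)\<rparr>"

definition free_gen :: "'a \<Rightarrow> ('a fword \<Rightarrow>\<^sub>0 int)" where
  "free_gen x = Poly_Mapping.single (FWord [x]) 1"

lemma free_ring_simps [simp]:
  "mult (free_ring X) = (*)" "one (free_ring X) = 1"
  "zero (free_ring X) = 0" "add (free_ring X) = (+)"
  by (simp_all add: free_ring_def)

lemma free_ring_carrier_iff:
  "f \<in> carrier (free_ring X) \<longleftrightarrow> (\<forall>w \<in> Poly_Mapping.keys f. set (letters w) \<subseteq> X)"
  by (simp add: free_ring_def)

lemma free_ring_closed:
  shows free_ring_zero_closed: "0 \<in> carrier (free_ring X)"
    and free_ring_one_closed: "1 \<in> carrier (free_ring X)"
    and free_ring_add_closed:
      "f \<in> carrier (free_ring X) \<Longrightarrow> g \<in> carrier (free_ring X) \<Longrightarrow> f + g \<in> carrier (free_ring X)"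
    and free_ring_diff_closed:
      "f \<in> carrier (free_ring X) \<Longrightarrow> g \<in> carrier (free_ring X) \<Longrightarrow> f - g \<in> carrier (free_ring X)"
    and free_ring_uminus_closed:
      "f \<in> carrier (free_ring X) \<Longrightarrow> - f \<in> carrier (free_ring X)"
    and free_ring_mult_closed:
      "f \<in> carrier (free_ring X) \<Longrightarrow> g \<in> carrier (free_ring X) \<Longrightarrow> f * g \<in> carrier (free_ring X)"
  using keys_add[of f g] keys_diff[of f g] keys_mult[of f g]
  by (fastforce simp: free_ring_carrier_iff zero_fword_def plus_fword_def)+

lemma free_gen_closed: "x \<in> X \<Longrightarrow> free_gen x \<in> carrier (free_ring X)"
  by (simp add: free_ring_carrier_iff free_gen_def)

lemma ring_free_ring: "ring (free_ring X)"
proof (rule ringI)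
  show "abelian_group (free_ring X)"
  proof (rule abelian_groupI)
    fix f assume "f \<in> carrier (free_ring X)"
    then show "\<exists>g \<in> carrier (free_ring X). g \<oplus>\<^bsub>free_ring X\<^esub> f = \<zero>\<^bsub>free_ring X\<^esub>"
      by (intro bexI[of _ "- f"]) (simp_all add: free_ring_uminus_closed)
  qed (simp_all add: free_ring_closed algebra_simps)
  show "monoid (free_ring X)"
    by (rule monoidI) (simp_all add: free_ring_closed algebra_simps)
qed (simp_all add: algebra_simps)

definition FK_gens :: "nat \<Rightarrow> (nat \<times> nat) set" where
  "FK_gens n = {(i, j). i \<in> {1..n} \<and> j \<in> {1..n} \<and> i \<noteq> j}"

abbreviation FK_free :: "nat \<Rightarrow> ((nat \<times> nat) fword \<Rightarrow>\<^sub>0 int) ring" where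
  "FK_free n \<equiv> free_ring (FK_gens n)"

text \<open>Each relation \<open>u = v\<close> is recorded as the element \<open>u - v\<close> of the free ring.\<close>

definition FK_rels :: "nat \<Rightarrow> ((nat \<times> nat) fword \<Rightarrow>\<^sub>0 int) set" where
  "FK_rels n =
    {free_gen (i, j) + free_gen (j, i) | i j.
       {i, j} \<subseteq> {1..n} \<and> distinct [i, j]} \<union>
    {free_gen (i, j) * free_gen (i, j) | i j.
       {i, j} \<subseteq> {1..n} \<and> distinct [i, j]} \<union>
    {free_gen (i, j) * free_gen (j, k) + free_gen (j, k) * free_gen (k, i)
       + free_gen (k, i) * free_gen (i, j) | i j k.
       {i, j, k} \<subseteq> {1..n} \<and> distinct [i, j, k]} \<union>
    {free_gen (i, j) * free_gen (k, l) - free_gen (k, l) * free_gen (i, j) | i j k l.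
       {i, j, k, l} \<subseteq> {1..n} \<and> distinct [i, j, k, l]}"

definition FK_ideal :: "nat \<Rightarrow> ((nat \<times> nat) fword \<Rightarrow>\<^sub>0 int) set" where
  "FK_ideal n = Idl\<^bsub>FK_free n\<^esub> (FK_rels n)"

definition FK_alg :: "nat \<Rightarrow> ((nat \<times> nat) fword \<Rightarrow>\<^sub>0 int) set ring" where
  "FK_alg n = FK_free n Quot FK_ideal n"

text \<open>The class of the generator \<open>[ij]\<close>; meaningful only for distinct \<open>i\<close>, \<open>j\<close> in \<open>{1..n}\<close>.\<close>

definition FK_gen :: "nat \<Rightarrow> nat \<Rightarrow> nat \<Rightarrow> ((nat \<times> nat) fword \<Rightarrow>\<^sub>0 int) set" where
  "FK_gen n i j = FK_ideal n +>\<^bsub>FK_free n\<^esub> free_gen (i, j)"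

text \<open>The list of indices is \<open>p - 1, \<dots>, 1, n, n - 1, \<dots>, p + 1\<close>.\<close>

definition dunkl_K :: "nat \<Rightarrow> nat \<Rightarrow> ((nat \<times> nat) fword \<Rightarrow>\<^sub>0 int) set" where
  "dunkl_K n p =
    \<one>\<^bsub>FK_alg n\<^esub> \<ominus>\<^bsub>FK_alg n\<^esub>
      foldr (\<lambda>i x. (\<one>\<^bsub>FK_alg n\<^esub> \<oplus>\<^bsub>FK_alg n\<^esub> FK_gen n i p) \<otimes>\<^bsub>FK_alg n\<^esub> x)
        (rev [1..<p] @ rev [Suc p..<Suc n]) \<one>\<^bsub>FK_alg n\<^esub>"

lemma FK_rels_subset: "FK_rels n \<subseteq> carrier (FK_free n)"
  unfolding FK_rels_def
  by (auto intro!: free_ring_closed free_gen_closed simp: FK_gens_def)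

lemma ideal_FK_ideal: "ideal (FK_ideal n) (FK_free n)"
  unfolding FK_ideal_def
  by (rule ring.genideal_ideal[OF ring_free_ring FK_rels_subset])

lemma ring_FK_alg: "ring (FK_alg n)"
  unfolding FK_alg_def by (rule ideal.quotient_is_ring[OF ideal_FK_ideal])

lemma FK_gen_closed:
  assumes "i \<in> {1..n}" "j \<in> {1..n}" "i \<noteq> j"
  shows "FK_gen n i j \<in> carrier (FK_alg n)"
proof -
  have "free_gen (i, j) \<in> carrier (FK_free n)"
    using assms by (intro free_gen_closed) (simp add: FK_gens_def)
  then show ?thesis
    unfolding FK_gen_def FK_alg_def FactRing_def A_RCOSETS_defs a_r_coset_def by auto
qed

end

theory Submission
  imports Defs "HOL-Algebra.Multiplicative_Group"
begin

text \<open>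
  The elements \<open>R i j = 1 + [ij]\<close> are unitary (\<open>R i j R j i = 1\<close>) and satisfy the Yang--Baxter
  equation, and \<open>R i j\<close> commutes with \<open>R k l\<close> for disjoint index pairs. Place the indices on a circle
  in descending order; removing \<open>p\<close> and \<open>q\<close> leaves the arc \<open>A\<close> from \<open>p\<close> down to \<open>q\<close> and the arc \<open>B\<close>
  from \<open>q\<close> down to \<open>p\<close>. With \<open>R X j\<close> the ordered product of \<open>R x j\<close> over \<open>x\<close> in \<open>X\<close>, the products
  in question are \<open>R A p R q p R B p\<close> and \<open>R B q R p q R A q\<close>. Yang--Baxter moves \<open>R q p\<close> through
  \<open>R B p R B q\<close>, after which it cancels against \<open>R p q\<close> and leaves \<open>R A p R B q R B p R A q\<close>. Since
  \<open>A\<close> and \<open>B\<close> are disjoint, \<open>R A p\<close> commutes with \<open>R B q\<close> and \<open>R B p\<close> with \<open>R A q\<close>, so this value is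
  symmetric under exchanging \<open>(p, A)\<close> with \<open>(q, B)\<close>.
\<close>

section \<open>Ordered products in monoids\<close>

context monoid
begin

lemma mult_left_commute:
  "\<lbrakk>x \<otimes> y = y \<otimes> x; x \<in> carrier G; y \<in> carrier G; z \<in> carrier G\<rbrakk> \<Longrightarrow> x \<otimes> (y \<otimes> z) = y \<otimes> (x \<otimes> z)"
  by (simp flip: m_assoc)

definition ordered_prod :: "('i \<Rightarrow> 'a) \<Rightarrow> 'i list \<Rightarrow> 'a" where
  "ordered_prod f xs = foldr (\<lambda>i x. f i \<otimes> x) xs \<one>"

lemma ordered_prod_Nil [simp]: "ordered_prod f [] = \<one>"
  and ordered_prod_Cons [simp]: "ordered_prod f (x # xs) = f x \<otimes> ordered_prod f xs"
  by (simp_all add: ordered_prod_def)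

lemma ordered_prod_closed:
  "f \<in> set xs \<rightarrow> carrier G \<Longrightarrow> ordered_prod f xs \<in> carrier G"
  by (induction xs) auto

lemma ordered_prod_append:
  "\<lbrakk>f \<in> set xs \<rightarrow> carrier G; f \<in> set ys \<rightarrow> carrier G\<rbrakk> \<Longrightarrow>
    ordered_prod f (xs @ ys) = ordered_prod f xs \<otimes> ordered_prod f ys"
  by (induction xs) (auto simp: ordered_prod_closed m_assoc)

lemma ordered_prod_commute:
  assumes "z \<in> carrier G" and "f \<in> set xs \<rightarrow> carrier G"
    and "\<And>x. x \<in> set xs \<Longrightarrow> z \<otimes> f x = f x \<otimes> z"
  shows "z \<otimes> ordered_prod f xs = ordered_prod f xs \<otimes> z"
  using assms
proof (induction xs)
  case Nil
  then show ?case by simp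
next
  case (Cons x xs)
  have closed: "f x \<in> carrier G" "ordered_prod f xs \<in> carrier G"
    using Cons.prems by (auto intro: ordered_prod_closed)
  have "z \<otimes> (f x \<otimes> ordered_prod f xs) = f x \<otimes> (z \<otimes> ordered_prod f xs)"
    using Cons.prems closed by (intro mult_left_commute) auto
  also have "\<dots> = f x \<otimes> (ordered_prod f xs \<otimes> z)"
    using Cons by auto
  finally show ?case
    using Cons.prems closed by (simp add: m_assoc)
qed

end

section \<open>Unitary solutions of the Yang--Baxter equation\<close>

locale yang_baxter_family = monoid G for G (structure) +
  fixes I :: "'i set" and R :: "'i \<Rightarrow> 'i \<Rightarrow> 'a"
  assumes R_closed: "\<lbrakk>i \<in> I; j \<in> I; i \<noteq> j\<rbrakk> \<Longrightarrow> R i j \<in> carrier G"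
    and R_unitary: "\<lbrakk>i \<in> I; j \<in> I; i \<noteq> j\<rbrakk> \<Longrightarrow> R i j \<otimes> R j i = \<one>"
    and R_commute: "\<lbrakk>{i, j, k, l} \<subseteq> I; distinct [i, j, k, l]\<rbrakk> \<Longrightarrow> R i j \<otimes> R k l = R k l \<otimes> R i j"
    and yang_baxter: "\<lbrakk>{i, j, k} \<subseteq> I; distinct [i, j, k]\<rbrakk> \<Longrightarrow>
      R i j \<otimes> (R i k \<otimes> R j k) = R j k \<otimes> (R i k \<otimes> R i j)"
begin

abbreviation row :: "'i \<Rightarrow> 'i list \<Rightarrow> 'a" where
  "row p xs \<equiv> ordered_prod (\<lambda>i. R i p) xs"

lemma R_Pi_closed:
  "\<lbrakk>p \<in> I; set xs \<subseteq> I - {p}\<rbrakk> \<Longrightarrow> (\<lambda>i. R i p) \<in> set xs \<rightarrow> carrier G"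
  by (auto intro: R_closed)

lemma row_closed:
  "\<lbrakk>p \<in> I; set xs \<subseteq> I - {p}\<rbrakk> \<Longrightarrow> row p xs \<in> carrier G"
  by (intro ordered_prod_closed R_Pi_closed)

lemma R_row_commute:
  assumes "{x, p, q} \<subseteq> I" "distinct [x, p, q]" "set ys \<subseteq> I - {x, p, q}"
  shows "R x p \<otimes> row q ys = row q ys \<otimes> R x p"
  using assms by (intro ordered_prod_commute R_commute) (auto intro: R_closed)

lemma row_row_commute:
  assumes "p \<in> I" "q \<in> I" "p \<noteq> q" "set xs \<subseteq> I - {p, q}" "set ys \<subseteq> I - {p, q}"
    and "set xs \<inter> set ys = {}"
  shows "row p xs \<otimes> row q ys = row q ys \<otimes> row p xs"
proof -
  have "row q ys \<otimes> R x p = R x p \<otimes> row q ys" if "x \<in> set xs" for x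
    using assms that by (intro R_row_commute[symmetric]) auto
  then have "row q ys \<otimes> row p xs = row p xs \<otimes> row q ys"
    using assms by (intro ordered_prod_commute row_closed R_Pi_closed) auto
  then show ?thesis ..
qed

lemma row_yang_baxter:
  assumes "p \<in> I" "q \<in> I" "p \<noteq> q" "set xs \<subseteq> I - {p, q}" "distinct xs"
  shows "R q p \<otimes> (row p xs \<otimes> row q xs) = row q xs \<otimes> (row p xs \<otimes> R q p)"
  using assms
proof (induction xs)
  case Nil
  then show ?case by (simp add: R_closed)
next
  case (Cons x xs)
  have [simp]: "R x p \<in> carrier G" "R x q \<in> carrier G" "R q p \<in> carrier G"
    "row p xs \<in> carrier G" "row q xs \<in> carrier G"
    using Cons.prems by (auto intro!: R_closed row_closed)
  have commute_q: "R x q \<otimes> row p xs = row p xs \<otimes> R x q"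
    using Cons.prems by (intro R_row_commute) auto
  have commute_p: "R x p \<otimes> row q xs = row q xs \<otimes> R x p"
    using Cons.prems by (intro R_row_commute) auto
  have exchange: "R x q \<otimes> (R x p \<otimes> R q p) = R q p \<otimes> (R x p \<otimes> R x q)"
    using Cons.prems by (intro yang_baxter) auto
  have IH: "R q p \<otimes> (row p xs \<otimes> row q xs) = row q xs \<otimes> (row p xs \<otimes> R q p)"
    using Cons by simp
  have "R q p \<otimes> (R x p \<otimes> row p xs \<otimes> (R x q \<otimes> row q xs))
      = R q p \<otimes> (R x p \<otimes> (R x q \<otimes> (row p xs \<otimes> row q xs)))"
    using mult_left_commute[OF commute_q] by (simp add: m_assoc)
  also have "\<dots> = (R x q \<otimes> (R x p \<otimes> R q p)) \<otimes> (row p xs \<otimes> row q xs)"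
    unfolding exchange by (simp add: m_assoc)
  also have "\<dots> = R x q \<otimes> (R x p \<otimes> (row q xs \<otimes> (row p xs \<otimes> R q p)))"
    by (simp add: m_assoc IH)
  also have "\<dots> = R x q \<otimes> (row q xs \<otimes> (R x p \<otimes> (row p xs \<otimes> R q p)))"
    using mult_left_commute[OF commute_p] by simp
  finally show ?case
    by (simp add: m_assoc)
qed

lemma cyclic_rows_mult:
  assumes "p \<in> I" "q \<in> I" "set A \<subseteq> I" "set B \<subseteq> I" "distinct (p # q # A @ B)"
  shows "row p (A @ q # B) \<otimes> row q (B @ p # A) = row p A \<otimes> (row q B \<otimes> (row p B \<otimes> row q A))"
proof -
  have [simp]: "row p A \<in> carrier G" "row p B \<in> carrier G" "row q A \<in> carrier G"
    "row q B \<in> carrier G" "R p q \<in> carrier G" "R q p \<in> carrier G"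
    using assms by (auto intro!: R_closed row_closed)
  have rows: "row p (A @ q # B) = row p A \<otimes> (R q p \<otimes> row p B)"
    "row q (B @ p # A) = row q B \<otimes> (R p q \<otimes> row q A)"
    using assms by (subst ordered_prod_append; auto intro: R_closed)+
  have cancel: "R q p \<otimes> (R p q \<otimes> row q A) = row q A"
    using assms by (auto simp: R_unitary simp flip: m_assoc)
  have "row p (A @ q # B) \<otimes> row q (B @ p # A)
      = row p A \<otimes> ((R q p \<otimes> (row p B \<otimes> row q B)) \<otimes> (R p q \<otimes> row q A))"
    by (simp add: rows m_assoc)
  also have "R q p \<otimes> (row p B \<otimes> row q B) = row q B \<otimes> (row p B \<otimes> R q p)"
    using assms by (intro row_yang_baxter) auto
  finally show ?thesis
    by (simp add: m_assoc cancel)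
qed

lemma cyclic_rows_commute:
  assumes "p \<in> I" "q \<in> I" "set A \<subseteq> I" "set B \<subseteq> I" "distinct (p # q # A @ B)"
  shows "row p (A @ q # B) \<otimes> row q (B @ p # A) = row q (B @ p # A) \<otimes> row p (A @ q # B)"
proof -
  have closed: "row p A \<in> carrier G" "row p B \<in> carrier G" "row q A \<in> carrier G"
    "row q B \<in> carrier G"
    using assms by (auto intro!: row_closed)
  have "row p (A @ q # B) \<otimes> row q (B @ p # A) = row p A \<otimes> (row q B \<otimes> (row p B \<otimes> row q A))"
    using assms by (rule cyclic_rows_mult)
  also have "\<dots> = row q B \<otimes> (row p A \<otimes> (row p B \<otimes> row q A))"
    using assms closed by (intro mult_left_commute row_row_commute) auto
  also have "row p B \<otimes> row q A = row q A \<otimes> row p B"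
    using assms by (intro row_row_commute) auto
  also have "row q B \<otimes> (row p A \<otimes> (row q A \<otimes> row p B))
      = row q (B @ p # A) \<otimes> row p (A @ q # B)"
    using assms by (intro cyclic_rows_mult[symmetric]) auto
  finally show ?thesis .
qed

end

section \<open>The Fomin--Kirillov relations\<close>

context ring
begin

lemma one_plus_nilpotent_unitary:
  assumes "a \<in> carrier R" "b \<in> carrier R" "a \<oplus> b = \<zero>" "a \<otimes> a = \<zero>"
  shows "(\<one> \<oplus> a) \<otimes> (\<one> \<oplus> b) = \<one>"
proof -
  have "b = \<ominus> a"
    using assms by (metis add.inv_equality add.m_comm)
  then show ?thesis
    using assms by (simp add: l_distr r_distr r_minus a_assoc r_neg l_neg)
qed

lemma one_plus_commute:
  assumes "a \<in> carrier R" "b \<in> carrier R" "a \<otimes> b = b \<otimes> a"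
  shows "(\<one> \<oplus> a) \<otimes> (\<one> \<oplus> b) = (\<one> \<oplus> b) \<otimes> (\<one> \<oplus> a)"
  using assms by (simp add: l_distr r_distr a_ac)

lemma one_minus_commute:
  assumes "a \<in> carrier R" "b \<in> carrier R" "a \<otimes> b = b \<otimes> a"
  shows "(\<one> \<ominus> a) \<otimes> (\<one> \<ominus> b) = (\<one> \<ominus> b) \<otimes> (\<one> \<ominus> a)"
  using one_plus_commute[of "\<ominus> a" "\<ominus> b"] assms by (simp add: minus_eq l_minus r_minus)

lemma one_plus_yang_baxter:
  assumes [simp]: "a \<in> carrier R" "b \<in> carrier R" "c \<in> carrier R"
    and square: "a \<otimes> a = \<zero>" "c \<otimes> c = \<zero>"
    and ac: "a \<otimes> c = c \<otimes> b \<oplus> b \<otimes> a" and ca: "c \<otimes> a = a \<otimes> b \<oplus> b \<otimes> c"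
  shows "(\<one> \<oplus> a) \<otimes> ((\<one> \<oplus> b) \<otimes> (\<one> \<oplus> c)) = (\<one> \<oplus> c) \<otimes> ((\<one> \<oplus> b) \<otimes> (\<one> \<oplus> a))"
proof -
  have "a \<otimes> (b \<otimes> c) = (a \<otimes> b \<oplus> b \<otimes> c) \<otimes> c"
    using square by (simp add: l_distr m_assoc)
  also have "\<dots> = c \<otimes> (c \<otimes> b \<oplus> b \<otimes> a)"
    by (simp add: m_assoc flip: ac ca)
  also have "\<dots> = c \<otimes> (b \<otimes> a)"
    using square by (simp add: r_distr flip: m_assoc)
  finally have cubic: "a \<otimes> (b \<otimes> c) = c \<otimes> (b \<otimes> a)" .
  show ?thesis
    by (simp add: l_distr r_distr cubic ac ca a_ac)
qed

end

locale fomin_kirillov_family = ring R for R (structure) +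
  fixes I :: "'i set" and g :: "'i \<Rightarrow> 'i \<Rightarrow> 'a"
  assumes gen_closed: "\<lbrakk>i \<in> I; j \<in> I; i \<noteq> j\<rbrakk> \<Longrightarrow> g i j \<in> carrier R"
    and gen_antisym: "\<lbrakk>i \<in> I; j \<in> I; i \<noteq> j\<rbrakk> \<Longrightarrow> g i j \<oplus> g j i = \<zero>"
    and gen_square: "\<lbrakk>i \<in> I; j \<in> I; i \<noteq> j\<rbrakk> \<Longrightarrow> g i j \<otimes> g i j = \<zero>"
    and gen_triangle: "\<lbrakk>{i, j, k} \<subseteq> I; distinct [i, j, k]\<rbrakk> \<Longrightarrow>
      g i j \<otimes> g j k \<oplus> g j k \<otimes> g k i \<oplus> g k i \<otimes> g i j = \<zero>"
    and gen_commute: "\<lbrakk>{i, j, k, l} \<subseteq> I; distinct [i, j, k, l]\<rbrakk> \<Longrightarrow> g i j \<otimes> g k l = g k l \<otimes> g i j"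
begin

lemma gen_swap: "\<lbrakk>i \<in> I; j \<in> I; i \<noteq> j\<rbrakk> \<Longrightarrow> g j i = \<ominus> g i j"
  using gen_antisym[of j i] by (intro add.inv_equality[symmetric]) (simp_all add: gen_closed)

lemma gen_triangle_ordered:
  assumes "{i, j, k} \<subseteq> I" "distinct [i, j, k]"
  shows "g i j \<otimes> g j k = g j k \<otimes> g i k \<oplus> g i k \<otimes> g i j"
proof -
  have closed: "g i j \<in> carrier R" "g j k \<in> carrier R" "g i k \<in> carrier R"
    using assms by (simp_all add: gen_closed)
  have "g k i = \<ominus> g i k"
    using assms by (intro gen_swap) auto
  then have "g i j \<otimes> g j k \<ominus> (g j k \<otimes> g i k \<oplus> g i k \<otimes> g i j) = \<zero>"
    using gen_triangle[OF assms] closed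
    by (simp add: l_minus r_minus minus_eq minus_add a_assoc)
  then show ?thesis
    using closed by simp
qed

lemma gen_triangle_reversed:
  assumes "{i, j, k} \<subseteq> I" "distinct [i, j, k]"
  shows "g j k \<otimes> g i j = g i j \<otimes> g i k \<oplus> g i k \<otimes> g j k"
proof -
  have "g i j \<in> carrier R" "g j k \<in> carrier R" "g i k \<in> carrier R"
    using assms by (simp_all add: gen_closed)
  moreover have "g j i = \<ominus> g i j" "g k j = \<ominus> g j k" "g k i = \<ominus> g i k"
    using assms by (auto intro!: gen_swap)
  ultimately show ?thesis
    using gen_triangle_ordered[of k j i] assms by (auto simp: l_minus r_minus)
qed

sublocale yang_baxter_family R I "\<lambda>i j. \<one> \<oplus> g i j"
proof unfold_locales
  fix i j
  assume "i \<in> I" "j \<in> I" "i \<noteq> j"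
  then show "\<one> \<oplus> g i j \<in> carrier R" and "(\<one> \<oplus> g i j) \<otimes> (\<one> \<oplus> g j i) = \<one>"
    by (simp_all add: one_plus_nilpotent_unitary gen_antisym gen_square gen_closed)
next
  fix i j k l
  assume "{i, j, k, l} \<subseteq> I" "distinct [i, j, k, l]"
  then show "(\<one> \<oplus> g i j) \<otimes> (\<one> \<oplus> g k l) = (\<one> \<oplus> g k l) \<otimes> (\<one> \<oplus> g i j)"
    by (intro one_plus_commute gen_commute gen_closed) auto
next
  fix i j k
  assume "{i, j, k} \<subseteq> I" "distinct [i, j, k]"
  then show "(\<one> \<oplus> g i j) \<otimes> ((\<one> \<oplus> g i k) \<otimes> (\<one> \<oplus> g j k))
      = (\<one> \<oplus> g j k) \<otimes> ((\<one> \<oplus> g i k) \<otimes> (\<one> \<oplus> g i j))"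
    by (intro one_plus_yang_baxter gen_square gen_triangle_ordered gen_triangle_reversed gen_closed)
      auto
qed

definition dunkl :: "'i \<Rightarrow> 'i list \<Rightarrow> 'a" where
  "dunkl p xs = \<one> \<ominus> row p xs"

lemma cyclic_dunkl_commute:
  assumes "p \<in> I" "q \<in> I" "set A \<subseteq> I" "set B \<subseteq> I" "distinct (p # q # A @ B)"
  shows "dunkl p (A @ q # B) \<otimes> dunkl q (B @ p # A) = dunkl q (B @ p # A) \<otimes> dunkl p (A @ q # B)"
  unfolding dunkl_def
  using assms by (intro one_minus_commute cyclic_rows_commute row_closed) auto

end

section \<open>The Fomin--Kirillov algebra\<close>

lemma free_ring_hom:
  assumes "ring_hom_ring (free_ring X) S h" "f \<in> carrier (free_ring X)" "g \<in> carrier (free_ring X)"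
  shows "h (f + g) = h f \<oplus>\<^bsub>S\<^esub> h g"
    and "h (f * g) = h f \<otimes>\<^bsub>S\<^esub> h g"
    and "h (f - g) = h f \<ominus>\<^bsub>S\<^esub> h g"
proof -
  interpret ring_hom_ring "free_ring X" S h by fact
  show "h (f + g) = h f \<oplus>\<^bsub>S\<^esub> h g" and "h (f * g) = h f \<otimes>\<^bsub>S\<^esub> h g"
    using hom_add[of f g] hom_mult[of f g] assms by simp_all
  have "f - g \<in> carrier (free_ring X)"
    using assms by (simp add: free_ring_diff_closed)
  then have "h f = h (f - g) \<oplus>\<^bsub>S\<^esub> h g"
    using hom_add[of "f - g" g] assms by simp
  then show "h (f - g) = h f \<ominus>\<^bsub>S\<^esub> h g"
    using assms \<open>f - g \<in> carrier (free_ring X)\<close>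
    by (simp add: S.minus_eq S.a_assoc S.r_neg)
qed

lemma (in ring) genideal_rcos_zero:
  assumes "S \<subseteq> carrier R" "r \<in> S"
  shows "Idl S +> r = \<zero>\<^bsub>R Quot (Idl S)\<^esub>"
  using assms genideal_self[of S] a_rcos_zero[OF genideal_ideal[of S]]
  by (auto simp: FactRing_def)

lemma FK_quot_hom: "ring_hom_ring (FK_free n) (FK_alg n) (a_r_coset (FK_free n) (FK_ideal n))"
  unfolding FK_alg_def by (rule ideal.rcos_ring_hom_ring[OF ideal_FK_ideal])

lemma FK_rel_rcos_zero:
  assumes "r \<in> FK_rels n"
  shows "FK_ideal n +>\<^bsub>FK_free n\<^esub> r = \<zero>\<^bsub>FK_alg n\<^esub>"
  unfolding FK_alg_def FK_ideal_def
  by (rule ring.genideal_rcos_zero[OF ring_free_ring FK_rels_subset assms])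

lemma free_gen_FK_closed:
  "\<lbrakk>i \<in> {1..n}; j \<in> {1..n}; i \<noteq> j\<rbrakk> \<Longrightarrow> free_gen (i, j) \<in> carrier (FK_free n)"
  by (rule free_gen_closed) (simp add: FK_gens_def)

lemma FK_alg_fomin_kirillov_family: "fomin_kirillov_family (FK_alg n) {1..n} (FK_gen n)"
proof -
  interpret FK: ring "FK_alg n"
    by (rule ring_FK_alg)
  note rcos_simps = free_ring_hom[OF FK_quot_hom] free_ring_closed free_gen_FK_closed
    FK_gen_def[symmetric]
  show ?thesis
  proof unfold_locales
    fix i j
    assume ij: "i \<in> {1..n}" "j \<in> {1..n}" "i \<noteq> j"
    then show "FK_gen n i j \<in> carrier (FK_alg n)"
      by (rule FK_gen_closed)
    have "free_gen (i, j) + free_gen (j, i) \<in> FK_rels n"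
      using ij by (auto simp: FK_rels_def)
    from FK_rel_rcos_zero[OF this] show "FK_gen n i j \<oplus>\<^bsub>FK_alg n\<^esub> FK_gen n j i = \<zero>\<^bsub>FK_alg n\<^esub>"
      using ij by (simp add: rcos_simps)
    have "free_gen (i, j) * free_gen (i, j) \<in> FK_rels n"
      using ij by (auto simp: FK_rels_def)
    from FK_rel_rcos_zero[OF this] show "FK_gen n i j \<otimes>\<^bsub>FK_alg n\<^esub> FK_gen n i j = \<zero>\<^bsub>FK_alg n\<^esub>"
      using ij by (simp add: rcos_simps)
  next
    fix i j k
    assume ijk: "{i, j, k} \<subseteq> {1..n}" "distinct [i, j, k]"
    then have "free_gen (i, j) * free_gen (j, k) + free_gen (j, k) * free_gen (k, i)
        + free_gen (k, i) * free_gen (i, j) \<in> FK_rels n"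
      unfolding FK_rels_def by blast
    from FK_rel_rcos_zero[OF this] show "FK_gen n i j \<otimes>\<^bsub>FK_alg n\<^esub> FK_gen n j k
        \<oplus>\<^bsub>FK_alg n\<^esub> FK_gen n j k \<otimes>\<^bsub>FK_alg n\<^esub> FK_gen n k i
        \<oplus>\<^bsub>FK_alg n\<^esub> FK_gen n k i \<otimes>\<^bsub>FK_alg n\<^esub> FK_gen n i j = \<zero>\<^bsub>FK_alg n\<^esub>"
      using ijk by (simp add: rcos_simps)
  next
    fix i j k l
    assume ijkl: "{i, j, k, l} \<subseteq> {1..n}" "distinct [i, j, k, l]"
    then have "free_gen (i, j) * free_gen (k, l) - free_gen (k, l) * free_gen (i, j) \<in> FK_rels n"
      unfolding FK_rels_def by blast
    from FK_rel_rcos_zero[OF this] show "FK_gen n i j \<otimes>\<^bsub>FK_alg n\<^esub> FK_gen n k l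
        = FK_gen n k l \<otimes>\<^bsub>FK_alg n\<^esub> FK_gen n i j"
      using ijkl by (simp add: rcos_simps FK_gen_closed)
  qed
qed

definition cyclic_predecessors :: "nat \<Rightarrow> nat \<Rightarrow> nat list" where
  "cyclic_predecessors n p = rev [1..<p] @ rev [Suc p..<Suc n]"

lemma upt_split_Cons:
  assumes "i \<le> j" "j < k"
  shows "[i..<k] = [i..<j] @ j # [Suc j..<k]"
  using assms upt_add_eq_append[of i j "k - j"] by (simp add: upt_conv_Cons)

lemma cyclic_predecessors_arcs:
  assumes "p \<in> {1..n}" "q \<in> {1..n}" "p \<noteq> q"
  obtains A B where "cyclic_predecessors n p = A @ q # B" "cyclic_predecessors n q = B @ p # A"
    "set A \<subseteq> {1..n}" "set B \<subseteq> {1..n}" "distinct (p # q # A @ B)"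
proof -
  let ?arcs = "\<lambda>p q A B.
    cyclic_predecessors n p = A @ q # B \<and> cyclic_predecessors n q = B @ p # A \<and>
    set A \<subseteq> {1..n} \<and> set B \<subseteq> {1..n} \<and> distinct (p # q # A @ B)"
  have arcs_less: "\<exists>A B. ?arcs p q A B" if "1 \<le> p" "p < q" "q \<le> n" for p q
  proof (intro exI)
    show "?arcs p q (rev [1..<p] @ rev [Suc q..<Suc n]) (rev [Suc p..<q])"
      using upt_split_Cons[of "Suc p" q "Suc n"] upt_split_Cons[of 1 p q] that
      by (auto simp: cyclic_predecessors_def simp del: upt_Suc)
  qed
  have "\<exists>A B. ?arcs p q A B"
  proof (cases "p < q")
    case True
    then show ?thesis using arcs_less assms by simp
  next
    case False
    then obtain A B where "?arcs q p A B"
      using arcs_less[of q p] assms by auto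
    then show ?thesis by (intro exI[of _ B] exI[of _ A]) auto
  qed
  then show ?thesis
    using that by blast
qed

theorem theorem2p2:
  fixes n p q :: nat
  assumes "n \<ge> 1" and "p \<in> {1..n}" and "q \<in> {1..n}"
  shows "dunkl_K n p \<otimes>\<^bsub>FK_alg n\<^esub> dunkl_K n q = dunkl_K n q \<otimes>\<^bsub>FK_alg n\<^esub> dunkl_K n p"
proof (cases "p = q")
  case True
  then show ?thesis by simp
next
  case False
  interpret FK: fomin_kirillov_family "FK_alg n" "{1..n}" "FK_gen n"
    by (rule FK_alg_fomin_kirillov_family)
  have dunkl: "dunkl_K n i = FK.dunkl i (cyclic_predecessors n i)" for i
    by (simp only: dunkl_K_def FK.dunkl_def FK.ordered_prod_def cyclic_predecessors_def)
  obtain A B where "cyclic_predecessors n p = A @ q # B" "cyclic_predecessors n q = B @ p # A"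
    "set A \<subseteq> {1..n}" "set B \<subseteq> {1..n}" "distinct (p # q # A @ B)"
    using assms(2,3) False by (rule cyclic_predecessors_arcs)
  then show ?thesis
    using FK.cyclic_dunkl_commute assms(2,3) by (simp add: dunkl)
qed

end
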